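(* Let $a$ and $a'$ be two symmetric, uniformly elliptic conductivity matrices on $\Omega$ with $L^\infty(\Omega)$ entries, and let $\mathcal V$ and $\mathcal V'$ be finite-dimensional subspaces of $(L^2(\Omega))^d$. For $f\in L^2(\Omega)$ let $u\in H^1_0(\Omega)$ be the weak solution of $-\operatorname{div}(a\nabla u)=f$ in $\Omega$, $u=0$ on $\partial\Omega$, and let $u'\in H^1_0(\Omega)$ be the weak solution of $-\operatorname{div}(a'\nabla u')=f$ in $\Omega$, $u'=0$ on $\partial\Omega$. If $(\operatorname{div} a\mathcal V)=(\operatorname{div} a'\mathcal V')$ as subspaces of $H^{-1}(\Omega)$, then $$\sup_{f\in L^2(\Omega)}\ \inf_{\zeta\in\mathcal V}\frac{\|(a(\nabla u-\zeta))_{pot}\|_{(L^2(\Omega))^d}}{\|f\|_{L^2(\Omega)}}=\sup_{f\in L^2(\Omega)}\ \inf_{\zeta\in\mathcal V'}\frac{\|(a'(\nabla u'-\zeta))_{pot}\|_{(L^2(\Omega))^d}}{\|f\|_{L^2(\Omega)}},$$ where the suprema are over $f\ne0$.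
   Context: $\Omega\subset\mathbb{R}^d$ ($d\ge 2$) is a bounded domain with $C^2$ boundary. Uniform ellipticity of $a$: $\lambda_{\min}(a)|\xi|^2\le\xi^Ta(x)\xi\le\lambda_{\max}(a)|\xi|^2$ for all $\xi\in\mathbb{R}^d$ and (almost) all $x\in\Omega$, with constants $0<\lambda_{\min}(a)\le\lambda_{\max}(a)<\infty$; similarly for $a'$. For $k\in(L^2(\Omega))^d$, $k_{pot}$ is the $L^2$-orthogonal projection of $k$ onto the closure of $\{\nabla g: g\in C_0^\infty(\Omega)\}$ in $(L^2(\Omega))^d$. For a finite-dimensional subspace $\mathcal V\subset(L^2(\Omega))^d$, $(\operatorname{div}a\mathcal V):=\{\operatorname{div}(a\zeta):\zeta\in\mathcal V\}\subset H^{-1}(\Omega)$. *)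

theory Defs
  imports "HOL-Analysis.Analysis"
begin

section \<open>Smooth functions and domains\<close>

primrec Ck :: "nat \<Rightarrow> ('a::euclidean_space \<Rightarrow> real) \<Rightarrow> bool" where
  "Ck 0 f \<longleftrightarrow> continuous_on UNIV f"
| "Ck (Suc k) f \<longleftrightarrow> (\<forall>x. f differentiable (at x)) \<and>
      (\<forall>b\<in>Basis. Ck k (\<lambda>x. frechet_derivative f (at x) b))"

definition grad :: "(real^'n \<Rightarrow> real) \<Rightarrow> real^'n \<Rightarrow> real^'n" where
  "grad f x = (\<chi> i. frechet_derivative f (at x) (axis i 1))"

definition test_fun :: "(real^'n) set \<Rightarrow> (real^'n \<Rightarrow> real) set" where
  "test_fun \<Omega> = {\<phi>. (\<forall>k. Ck k \<phi>) \<and>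
      compact (closure {x. \<phi> x \<noteq> 0}) \<and> closure {x. \<phi> x \<noteq> 0} \<subseteq> \<Omega>}"

text \<open>
  Near every boundary point, \<open>\<Omega>\<close> is the strict epigraph of a \<open>C\<^sup>2\<close> function \<open>\<gamma>\<close> of the
  variables orthogonal to some unit vector \<open>e\<close>. The function \<open>\<gamma>\<close> is given on the whole space
  and is constant in direction \<open>e\<close>.
\<close>

definition C2_boundary :: "(real^'n) set \<Rightarrow> bool" where
  "C2_boundary \<Omega> \<longleftrightarrow> (\<forall>p\<in>frontier \<Omega>. \<exists>r e \<gamma>. r > 0 \<and> norm e = 1 \<and> Ck 2 \<gamma> \<and>
      (\<forall>x t. \<gamma> (x + t *\<^sub>R e) = \<gamma> x) \<and>
      \<Omega> \<inter> ball p r = {x \<in> ball p r. \<gamma> x < x \<bullet> e})"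

definition bounded_C2_domain :: "(real^'n) set \<Rightarrow> bool" where
  "bounded_C2_domain \<Omega> \<longleftrightarrow>
      open \<Omega> \<and> connected \<Omega> \<and> \<Omega> \<noteq> {} \<and> bounded \<Omega> \<and> C2_boundary \<Omega>"

section \<open>Square integrable functions\<close>

text \<open>
  Elements of \<open>L\<^sup>2\<close> are represented by functions on the whole space, of which only the values
  almost everywhere in \<open>\<Omega>\<close> matter. With \<open>'b = real\<close> this is \<open>L\<^sup>2(\<Omega>)\<close>, with
  \<open>'b = real^'n\<close> it is \<open>(L\<^sup>2(\<Omega>))\<^sup>d\<close>.
\<close>

definition L2 :: "(real^'n) set \<Rightarrow> (real^'n \<Rightarrow> 'b::euclidean_space) set" where
  "L2 \<Omega> = {f. f \<in> borel_measurable (lebesgue_on \<Omega>) \<and>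
      integrable (lebesgue_on \<Omega>) (\<lambda>x. (norm (f x))\<^sup>2)}"

definition L2_inner ::
  "(real^'n) set \<Rightarrow> (real^'n \<Rightarrow> 'b::euclidean_space) \<Rightarrow> (real^'n \<Rightarrow> 'b) \<Rightarrow> real" where
  "L2_inner \<Omega> f g = (LINT x|lebesgue_on \<Omega>. f x \<bullet> g x)"

definition L2_norm :: "(real^'n) set \<Rightarrow> (real^'n \<Rightarrow> 'b::euclidean_space) \<Rightarrow> real" where
  "L2_norm \<Omega> f = sqrt (LINT x|lebesgue_on \<Omega>. (norm (f x))\<^sup>2)"

definition L2_closure ::
  "(real^'n) set \<Rightarrow> (real^'n \<Rightarrow> 'b::euclidean_space) set \<Rightarrow> (real^'n \<Rightarrow> 'b) set" where
  "L2_closure \<Omega> S = {f \<in> L2 \<Omega>. \<forall>\<epsilon>>0. \<exists>g\<in>S. L2_norm \<Omega> (\<lambda>x. f x - g x) < \<epsilon>}"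

text \<open>
  A linear subspace of \<open>L\<^sup>2\<close> is given by the set of all representatives of its elements; hence the
  closure under equality almost everywhere.
\<close>

definition L2_subspace ::
  "(real^'n) set \<Rightarrow> (real^'n \<Rightarrow> 'b::euclidean_space) set \<Rightarrow> bool" where
  "L2_subspace \<Omega> V \<longleftrightarrow> V \<subseteq> L2 \<Omega> \<and> (\<lambda>x. 0) \<in> V \<and>
      (\<forall>f\<in>V. \<forall>g\<in>V. (\<lambda>x. f x + g x) \<in> V) \<and>
      (\<forall>c. \<forall>f\<in>V. (\<lambda>x. c *\<^sub>R f x) \<in> V) \<and>
      (\<forall>f\<in>V. \<forall>g\<in>L2 \<Omega>. (AE x in lebesgue_on \<Omega>. f x = g x) \<longrightarrow> g \<in> V)"

definition finite_dim_L2_subspace ::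
  "(real^'n) set \<Rightarrow> (real^'n \<Rightarrow> 'b::euclidean_space) set \<Rightarrow> bool" where
  "finite_dim_L2_subspace \<Omega> V \<longleftrightarrow> L2_subspace \<Omega> V \<and>
      (\<exists>B. finite B \<and> B \<subseteq> V \<and>
        (\<forall>f\<in>V. \<exists>c. AE x in lebesgue_on \<Omega>. f x = (\<Sum>b\<in>B. c b *\<^sub>R b x)))"

text \<open>The orthogonal projection onto a closed subspace, unique up to equality almost everywhere.\<close>

definition L2_proj ::
  "(real^'n) set \<Rightarrow> (real^'n \<Rightarrow> 'b::euclidean_space) set \<Rightarrow> (real^'n \<Rightarrow> 'b) \<Rightarrow> real^'n \<Rightarrow> 'b"
  where
  "L2_proj \<Omega> S k = (SOME p. p \<in> S \<and> (\<forall>q\<in>S. L2_inner \<Omega> (\<lambda>x. k x - p x) q = 0))"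

definition pot :: "(real^'n) set \<Rightarrow> (real^'n \<Rightarrow> real^'n) \<Rightarrow> real^'n \<Rightarrow> real^'n" where
  "pot \<Omega> k = L2_proj \<Omega> (L2_closure \<Omega> (grad ` test_fun \<Omega>)) k"

section \<open>Sobolev spaces\<close>

definition has_weak_grad ::
  "(real^'n) set \<Rightarrow> (real^'n \<Rightarrow> real) \<Rightarrow> (real^'n \<Rightarrow> real^'n) \<Rightarrow> bool" where
  "has_weak_grad \<Omega> u g \<longleftrightarrow> (\<forall>\<phi>\<in>test_fun \<Omega>. \<forall>i.
      (LINT x|lebesgue_on \<Omega>. u x * grad \<phi> x $ i) = - (LINT x|lebesgue_on \<Omega>. g x $ i * \<phi> x))"

definition H1 :: "(real^'n) set \<Rightarrow> (real^'n \<Rightarrow> real) set" where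
  "H1 \<Omega> = {u \<in> L2 \<Omega>. \<exists>g\<in>L2 \<Omega>. has_weak_grad \<Omega> u g}"

text \<open>The weak gradient is unique up to equality almost everywhere.\<close>

definition weak_grad :: "(real^'n) set \<Rightarrow> (real^'n \<Rightarrow> real) \<Rightarrow> real^'n \<Rightarrow> real^'n" where
  "weak_grad \<Omega> u = (SOME g. g \<in> L2 \<Omega> \<and> has_weak_grad \<Omega> u g)"

definition H1_norm :: "(real^'n) set \<Rightarrow> (real^'n \<Rightarrow> real) \<Rightarrow> real" where
  "H1_norm \<Omega> u = sqrt ((L2_norm \<Omega> u)\<^sup>2 + (L2_norm \<Omega> (weak_grad \<Omega> u))\<^sup>2)"

definition H10 :: "(real^'n) set \<Rightarrow> (real^'n \<Rightarrow> real) set" where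
  "H10 \<Omega> = {u \<in> H1 \<Omega>. \<forall>\<epsilon>>0. \<exists>\<phi>\<in>test_fun \<Omega>. H1_norm \<Omega> (\<lambda>x. u x - \<phi> x) < \<epsilon>}"

text \<open>
  The divergence of a square integrable field as an element of the dual \<open>H\<^sup>-\<^sup>1(\<Omega>)\<close> of
  \<open>H\<^sub>0\<^sup>1(\<Omega>)\<close>. Restricting the functional to \<open>H10 \<Omega>\<close> (with the value \<open>undefined\<close> elsewhere)
  makes equality of functionals on \<open>H\<^sub>0\<^sup>1(\<Omega>)\<close> the equality of HOL functions.
\<close>

definition div_Hm1 ::
  "(real^'n) set \<Rightarrow> (real^'n \<Rightarrow> real^'n) \<Rightarrow> (real^'n \<Rightarrow> real) \<Rightarrow> real" where
  "div_Hm1 \<Omega> F = restrict (\<lambda>v. - L2_inner \<Omega> F (weak_grad \<Omega> v)) (H10 \<Omega>)"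

section \<open>Elliptic equations\<close>

definition Linf :: "(real^'n) set \<Rightarrow> (real^'n \<Rightarrow> real) set" where
  "Linf \<Omega> = {f. f \<in> borel_measurable (lebesgue_on \<Omega>) \<and>
      (\<exists>C. AE x in lebesgue_on \<Omega>. \<bar>f x\<bar> \<le> C)}"

definition uniformly_elliptic :: "(real^'n) set \<Rightarrow> (real^'n \<Rightarrow> real^'n^'n) \<Rightarrow> bool" where
  "uniformly_elliptic \<Omega> a \<longleftrightarrow> (\<exists>lmin lmax. 0 < lmin \<and> lmin \<le> lmax \<and>
      (AE x in lebesgue_on \<Omega>. \<forall>\<xi>. lmin * (norm \<xi>)\<^sup>2 \<le> \<xi> \<bullet> (a x *v \<xi>) \<and>
        \<xi> \<bullet> (a x *v \<xi>) \<le> lmax * (norm \<xi>)\<^sup>2))"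

definition conductivity :: "(real^'n) set \<Rightarrow> (real^'n \<Rightarrow> real^'n^'n) \<Rightarrow> bool" where
  "conductivity \<Omega> a \<longleftrightarrow> (\<forall>i j. (\<lambda>x. a x $ i $ j) \<in> Linf \<Omega>) \<and>
      (AE x in lebesgue_on \<Omega>. transpose (a x) = a x) \<and> uniformly_elliptic \<Omega> a"

text \<open>Weak solutions of \<open>-div (a \<nabla>u) = f\<close> in \<open>\<Omega>\<close>, \<open>u = 0\<close> on the boundary of \<open>\<Omega>\<close>.\<close>

definition weak_solution ::
  "(real^'n) set \<Rightarrow> (real^'n \<Rightarrow> real^'n^'n) \<Rightarrow> (real^'n \<Rightarrow> real) \<Rightarrow> (real^'n \<Rightarrow> real) \<Rightarrow> bool"
  where
  "weak_solution \<Omega> a f u \<longleftrightarrow> u \<in> H10 \<Omega> \<and>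
      (\<forall>v\<in>H10 \<Omega>. L2_inner \<Omega> (\<lambda>x. a x *v weak_grad \<Omega> u x) (weak_grad \<Omega> v) = L2_inner \<Omega> f v)"

end

theory Submission
  imports Defs
begin

text \<open>
  For fixed \<open>f\<close>, both \<open>div (a \<nabla>u)\<close> and \<open>div (a' \<nabla>u')\<close> equal \<open>-f\<close>. If \<open>\<zeta> \<in> V\<close> and \<open>\<zeta>' \<in> V'\<close> satisfy
  \<open>div (a \<zeta>) = div (a' \<zeta>')\<close>, then \<open>a (\<nabla>u - \<zeta>)\<close> and \<open>a' (\<nabla>u' - \<zeta>')\<close> have the same divergence, that
  is, the same inner products with gradients of test functions, and therefore the same potential
  part. Hence the two infima range over the same numbers. The analytic content is that the
  gradient of a test function agrees almost everywhere with its weak gradient, which rests on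
  integration by parts and on the fundamental lemma of the calculus of variations.
\<close>

section \<open>Smooth functions\<close>

text \<open>The product rule multiplies one function by a derivative of the other, which has one
  degree less; lowering the degree brings both factors to the same \<open>k\<close>.\<close>

lemma Ck_antimono: "Ck (Suc k) f \<Longrightarrow> Ck k f"
proof (induction k arbitrary: f)
  case 0
  then show ?case
    by (simp add: continuous_on_eq_continuous_within differentiable_imp_continuous_within)
qed auto

lemma Ck_imp_continuous: "Ck k f \<Longrightarrow> continuous_on UNIV f"
proof (induction k)
  case (Suc k)
  then show ?case using Ck_antimono by blast
qed simp

lemma Ck_const: "Ck k (\<lambda>x. c)"
  by (induction k arbitrary: c) auto

lemma Ck_add: "Ck k f \<Longrightarrow> Ck k g \<Longrightarrow> Ck k (\<lambda>x. f x + g x)"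
proof (induction k arbitrary: f g)
  case (Suc k)
  have "frechet_derivative (\<lambda>x. f x + g x) (at x) b
      = frechet_derivative f (at x) b + frechet_derivative g (at x) b" for x b
    using frechet_derivative_at[OF has_derivative_add[of f "frechet_derivative f (at x)" "at x" g
          "frechet_derivative g (at x)"]] Suc.prems
    by (auto simp: frechet_derivative_works dest: fun_cong[of _ _ b])
  with Suc show ?case by simp
qed (auto intro: continuous_intros)

lemma frechet_derivative_mult_real:
  fixes f g :: "'a::real_normed_vector \<Rightarrow> real"
  assumes "f differentiable (at x)" "g differentiable (at x)"
  shows "frechet_derivative (\<lambda>x. f x * g x) (at x) b
      = f x * frechet_derivative g (at x) b + frechet_derivative f (at x) b * g x"
  using has_derivative_mult[OF assms[unfolded frechet_derivative_works]]
  by (auto dest!: frechet_derivative_at fun_cong[of _ _ b])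

lemma Ck_mult: "Ck k f \<Longrightarrow> Ck k g \<Longrightarrow> Ck k (\<lambda>x. f x * g x)"
proof (induction k arbitrary: f g)
  case (Suc k)
  have "Ck k (\<lambda>x. f x * frechet_derivative g (at x) b + frechet_derivative f (at x) b * g x)"
    if "b \<in> Basis" for b
    using that Suc.prems Ck_antimono[OF Suc.prems(1)] Ck_antimono[OF Suc.prems(2)]
    by (intro Ck_add Suc.IH) auto
  with Suc.prems show ?case by (simp add: frechet_derivative_mult_real)
qed (auto intro: continuous_intros)

lemma Ck_prod: "(\<And>i. i \<in> I \<Longrightarrow> Ck k (f i)) \<Longrightarrow> Ck k (\<lambda>x. \<Prod>i\<in>I. f i x)"
  by (induction I rule: infinite_finite_induct) (auto intro: Ck_const Ck_mult)

lemma Ck_diff: "Ck k f \<Longrightarrow> Ck k g \<Longrightarrow> Ck k (\<lambda>x. f x - g x)"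
  using Ck_add[OF _ Ck_mult[OF Ck_const[of k "-1"]], of f g] by simp

text \<open>
  Up to linear combinations this family is closed under differentiation, so \<open>C\<^sup>k\<close> for all members
  follows by one induction on \<open>k\<close>.
\<close>

definition flat :: "nat \<Rightarrow> real \<Rightarrow> real" where
  "flat m t = (if t > 0 then exp (- 1 / t) / t ^ m else 0)"

text \<open>Only t = 0 needs an argument: exp (- 1 / h) decays faster than any power of h as h tends
  to 0 from the right, so the difference quotient tends to 0.\<close>

lemma flat_derivative:
  "(flat m has_real_derivative flat (m + 2) t - real m * flat (m + 1) t) (at t)"
proof -
  consider "t > 0" | "t = 0" | "t < 0" by linarith
  then show ?thesis
  proof cases
    case 1
    have "((\<lambda>t. exp (- 1 / t) / t ^ m) has_real_derivative
        (exp (- 1 / t) / t\<^sup>2 * t ^ m - exp (- 1 / t) * (real m * t ^ (m - 1))) / (t ^ m * t ^ m))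
        (at t)"
      using 1 by (auto intro!: derivative_eq_intros simp: power2_eq_square)
    \<comment> \<open>At \<open>m = 0\<close> the truncated \<open>m - 1\<close> is harmless, since
      both sides carry the factor \<open>real m\<close>.\<close>
    moreover have "real m * t ^ (m - 1) = real m * t ^ m / t"
      using 1 by (cases m) auto
    moreover have "(exp (- 1 / t) / t\<^sup>2 * t ^ m - exp (- 1 / t) * (real m * t ^ m / t)) / (t ^ m * t ^ m)
        = flat (m + 2) t - real m * flat (m + 1) t"
      using 1 by (simp add: flat_def field_simps power2_eq_square)
    ultimately have *: "((\<lambda>t. exp (- 1 / t) / t ^ m) has_real_derivative
        flat (m + 2) t - real m * flat (m + 1) t) (at t)"
      by (simp only:)
    show ?thesis
      by (rule has_field_derivative_transform_within_open[OF *, of "{0<..}"])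
        (use 1 in \<open>auto simp: flat_def\<close>)
  next
    case 3
    show ?thesis
      by (rule has_field_derivative_transform_within_open[of "\<lambda>_. 0" _ _ "{..<0}"])
        (use 3 in \<open>auto simp: flat_def\<close>)
  next
    case 2
    have "((\<lambda>h. flat m h / h) \<longlongrightarrow> 0) (at_right 0)"
    proof (rule Lim_transform_eventually)
      \<comment> \<open>Substitute h = 1 / y: the quotient becomes y ^ (m + 1) / exp y with y
        tending to infinity.\<close>
      show "((\<lambda>h::real. exp (- 1 / h) / h ^ m / h) \<longlongrightarrow> 0) (at_right 0)"
        using filterlim_compose[OF tendsto_power_div_exp_0[of "m + 1"] filterlim_inverse_at_top_right]
        by (simp add: exp_minus field_simps)
    qed (auto simp: flat_def eventually_at_right_field intro: exI[of _ 1])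
    moreover have "((\<lambda>h. flat m h / h) \<longlongrightarrow> 0) (at_left 0)"
      by (rule Lim_transform_eventually[OF tendsto_const])
        (auto simp: flat_def eventually_at_left_field intro: exI[of _ "-1"])
    ultimately have "((\<lambda>h. flat m h / h) \<longlongrightarrow> 0) (at 0)"
      by (simp add: filterlim_at_split)
    then show ?thesis
      unfolding 2 DERIV_def by (simp add: flat_def)
  qed
qed

text \<open>An arbitrary vector \<open>e\<close> and offset \<open>c\<close> let the smooth factors
  of a bump absorb scalings and reflections.\<close>

lemma flat_frechet_derivative:
  fixes e :: "'a::euclidean_space"
  shows "((\<lambda>x. flat m (x \<bullet> e - c)) has_derivative
      (\<lambda>b. (flat (m + 2) (x \<bullet> e - c) - real m * flat (m + 1) (x \<bullet> e - c)) * (b \<bullet> e))) (at x)"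
  by (rule has_derivative_compose[OF _ flat_derivative[unfolded has_field_derivative_def]])
    (auto intro!: derivative_eq_intros)

lemma Ck_flat: "Ck k (\<lambda>x. flat m (x \<bullet> e - c))"
proof (induction k arbitrary: m)
  case 0
  show ?case
    using flat_frechet_derivative[THEN has_derivative_continuous]
    by (auto simp: continuous_on_eq_continuous_within)
next
  case (Suc k)
  have "Ck k (\<lambda>x. (flat (m + 2) (x \<bullet> e - c) - real m * flat (m + 1) (x \<bullet> e - c)) * (b \<bullet> e))" for b
    by (intro Ck_mult Ck_diff Ck_const Suc)
  then show ?case
    using flat_frechet_derivative[of m e c]
    by (auto simp: differentiable_def frechet_derivative_at[OF flat_frechet_derivative, symmetric]
        simp del: One_nat_def add_2_eq_Suc')
qed

section \<open>Test functions\<close>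

lemma flat_0_bounds: "0 \<le> flat 0 t" "flat 0 t \<le> 1" "flat 0 t \<noteq> 0 \<longleftrightarrow> t > 0"
  by (auto simp: flat_def)

text \<open>The shift by 1 is for compact supports: the value is 0 for s \<le> 1 / Suc n, while for
  fixed s > 0 the argument tends to infinity, where \<open>flat 0\<close> tends to 1.\<close>

lemma flat_0_tendsto_1:
  assumes "s > 0"
  shows "(\<lambda>n. flat 0 (real (Suc n) * s - 1)) \<longlonglongrightarrow> 1"
proof -
  have "filterlim (\<lambda>n. - 1 + real (Suc n) * s) at_top sequentially"
    by (intro filterlim_tendsto_add_at_top[OF tendsto_const]
        filterlim_at_top_mult_tendsto_pos[OF tendsto_const assms]
        filterlim_compose[OF filterlim_real_sequentially filterlim_Suc])
  then have lim: "filterlim (\<lambda>n. real (Suc n) * s - 1) at_top sequentially"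
    by (simp add: algebra_simps)
  have "((\<lambda>t. exp (- inverse t)) \<longlongrightarrow> exp (- 0)) (at_top :: real filter)"
    by (intro tendsto_intros tendsto_inverse_0_at_top filterlim_ident)
  then have "((\<lambda>t. flat 0 t) \<longlongrightarrow> 1) at_top"
    by (rule Lim_transform_eventually[THEN tendsto_eq_rhs])
      (auto simp: flat_def inverse_eq_divide intro: eventually_mono[OF eventually_gt_at_top[of 0]])
  from filterlim_compose[OF this lim] show ?thesis .
qed

text \<open>A compact K off which \<phi> vanishes contains the closure of the nonzero set, so
  supports need not be computed exactly.\<close>

lemma test_funI:
  assumes "\<And>k. Ck k \<phi>" "compact K" "\<And>x. x \<notin> K \<Longrightarrow> \<phi> x = 0" "K \<subseteq> U"
  shows "\<phi> \<in> test_fun U"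
proof -
  have "closure {x. \<phi> x \<noteq> 0} \<subseteq> K"
    using assms(2,3) by (intro closure_minimal compact_imp_closed) auto
  then show ?thesis
    unfolding test_fun_def using assms
    by (auto simp: compact_closure intro: bounded_subset[OF compact_imp_bounded])
qed

lemma test_funE:
  assumes "\<phi> \<in> test_fun U"
  obtains K where "\<And>k. Ck k \<phi>" "compact K" "\<And>x. x \<notin> K \<Longrightarrow> \<phi> x = 0" "K \<subseteq> U"
  using assms closure_subset[of "{x. \<phi> x \<noteq> 0}"] unfolding test_fun_def by blast

lemma test_fun_mult:
  assumes "\<phi> \<in> test_fun U" "\<psi> \<in> test_fun W"
  shows "(\<lambda>x. \<phi> x * \<psi> x) \<in> test_fun U"
proof -
  obtain K where "\<And>k. Ck k \<phi>" "compact K" "\<And>x. x \<notin> K \<Longrightarrow> \<phi> x = 0" "K \<subseteq> U"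
    using assms(1) by (metis test_funE)
  moreover have "\<And>k. Ck k \<psi>"
    using assms(2) by (simp add: test_fun_def)
  ultimately show ?thesis by (intro test_funI[of _ K] Ck_mult) auto
qed

text \<open>The bumps are products of one-dimensional cutoffs, two for each coordinate direction.
  The bounds 0 and 1 and the pointwise limit prepare dominated convergence.\<close>

lemma test_fun_box:
  fixes a b :: "real^'n"
  obtains \<psi> where "\<And>n. \<psi> n \<in> test_fun (box a b)" "\<And>n x. 0 \<le> \<psi> n x" "\<And>n x. \<psi> n x \<le> 1"
    "\<And>x. x \<in> box a b \<Longrightarrow> (\<lambda>n. \<psi> n x) \<longlonglongrightarrow> (1::real)"
proof
  define \<psi> where "\<psi> n x = (\<Prod>e\<in>Basis. flat 0 (real (Suc n) * (x \<bullet> e - a \<bullet> e) - 1)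
      * flat 0 (real (Suc n) * (b \<bullet> e - x \<bullet> e) - 1))" for n x
  show "0 \<le> \<psi> n x" "\<psi> n x \<le> 1" for n x
    unfolding \<psi>_def
    by (auto intro!: prod_nonneg prod_le_1 mult_nonneg_nonneg mult_le_one simp: flat_0_bounds)
  show "(\<lambda>n. \<psi> n x) \<longlonglongrightarrow> 1" if "x \<in> box a b" for x
  proof -
    have "(\<lambda>n. \<psi> n x) \<longlonglongrightarrow> (\<Prod>e\<in>(Basis :: (real^'n) set). 1 * 1)"
      unfolding \<psi>_def using that
      by (intro tendsto_prod tendsto_mult flat_0_tendsto_1) (auto simp: box_def)
    then show ?thesis by simp
  qed
  show "\<psi> n \<in> test_fun (box a b)" for n
  proof (rule test_funI)
    \<comment> \<open>Both factors are brought to the form of \<open>Ck_flat\<close>; the second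
      uses a reflected vector.\<close>
    have "\<psi> n = (\<lambda>x. \<Prod>e\<in>Basis. flat 0 (x \<bullet> (real (Suc n) *\<^sub>R e) - (real (Suc n) * (a \<bullet> e) + 1))
      * flat 0 (x \<bullet> (- real (Suc n) *\<^sub>R e) - (1 - real (Suc n) * (b \<bullet> e))))"
      unfolding \<psi>_def by (intro ext prod.cong refl) (simp add: algebra_simps)
    then show "Ck k (\<psi> n)" for k
      by (simp only: Ck_prod Ck_mult Ck_flat)
    \<comment> \<open>Each factor vanishes within distance r of its face, so \<psi> n lives on the
      box shrunk by r on all sides, which may be empty.\<close>
    define r where "r = 1 / real (Suc n)"
    let ?K = "cbox (a + r *\<^sub>R One) (b - r *\<^sub>R One)"
    have K: "x \<in> ?K \<longleftrightarrow> (\<forall>e\<in>Basis. a \<bullet> e + r \<le> x \<bullet> e \<and> x \<bullet> e \<le> b \<bullet> e - r)" for x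
      by (simp add: mem_box inner_add_left inner_diff_left)
    show "compact ?K"
      by (rule compact_cbox)
    have "r > 0" by (simp add: r_def)
    then show "?K \<subseteq> box a b"
      unfolding subset_iff K by (fastforce simp: mem_box)
    show "\<psi> n x = 0" if "x \<notin> ?K" for x
    proof -
      have "\<exists>e\<in>Basis. x \<bullet> e - a \<bullet> e \<le> r \<or> b \<bullet> e - x \<bullet> e \<le> r"
      proof (rule ccontr)
        assume "\<not> ?thesis"
        then have "x \<in> ?K"
          unfolding K by fastforce
        with that show False by blast
      qed
      then obtain e where "e \<in> Basis" "x \<bullet> e - a \<bullet> e \<le> r \<or> b \<bullet> e - x \<bullet> e \<le> r"
        by blast
      moreover have "flat 0 (real (Suc n) * s - 1) = 0" if "s \<le> r" for s
        using that by (auto simp: flat_def r_def field_simps)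
      ultimately show ?thesis
        unfolding \<psi>_def by (auto intro!: prod_zero)
    qed
  qed
qed

text \<open>
  \<open>U\<close> is a countable union of boxes \<open>D j\<close>; in \<open>1 - (\<Prod>j<n. 1 - \<psi> j n)\<close> the bumps \<open>\<psi> j n\<close> of the
  first \<open>n\<close> boxes are combined without losing smoothness or the bound \<open>1\<close>.
\<close>

lemma test_fun_open:
  fixes U :: "(real^'n) set"
  assumes "open U"
  obtains \<psi> where "\<And>n. \<psi> n \<in> test_fun U" "\<And>n x. 0 \<le> \<psi> n x" "\<And>n x. \<psi> n x \<le> (1::real)"
    "\<And>x. x \<in> U \<Longrightarrow> (\<lambda>n. \<psi> n x) \<longlonglongrightarrow> 1"
proof -
  obtain \<D> where \<D>: "countable \<D>" "\<D> \<subseteq> Pow U" "\<And>X. X \<in> \<D> \<Longrightarrow> \<exists>a b. X = box a b" "\<Union>\<D> = U"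
    using open_countable_Union_open_box[OF assms] by metis
  \<comment> \<open>The added empty set, itself a box, makes the family nonempty, so that
    \<open>from_nat_into\<close> enumerates it in every case.\<close>
  define D where "D = from_nat_into (insert {} \<D>)"
  have D: "range D = insert {} \<D>"
    unfolding D_def using \<D>(1) by (intro range_from_nat_into) auto
  have "\<exists>a b. D j = box a b" for j
  proof (cases "D j = {}")
    case True
    then show ?thesis by (intro exI[of _ 0]) simp
  next
    case False
    then show ?thesis using \<D>(3)[of "D j"] D by blast
  qed
  then have "\<exists>\<psi>. (\<forall>n. \<psi> n \<in> test_fun (D j)) \<and> (\<forall>n x. 0 \<le> \<psi> n x \<and> \<psi> n x \<le> (1::real)) \<and>
      (\<forall>x\<in>D j. (\<lambda>n. \<psi> n x) \<longlonglongrightarrow> 1)" for j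
    by (metis test_fun_box)
  then obtain \<psi> where \<psi>: "\<And>j n. \<psi> j n \<in> test_fun (D j)"
    "\<And>j n x. 0 \<le> \<psi> j n x" "\<And>j n x. \<psi> j n x \<le> (1::real)"
    "\<And>j x. x \<in> D j \<Longrightarrow> (\<lambda>n. \<psi> j n x) \<longlonglongrightarrow> 1"
    by metis
  define \<eta> where "\<eta> n x = 1 - (\<Prod>j<n. 1 - \<psi> j n x)" for n x
  show thesis
  proof
    show "0 \<le> \<eta> n x" "\<eta> n x \<le> 1" for n x
      unfolding \<eta>_def by (auto intro!: prod_nonneg prod_le_1 simp: \<psi>)
    show "\<eta> n \<in> test_fun U" for n
    proof -
      \<comment> \<open>For fixed n only the first n bumps enter, and the finite union of their
        supports is compact.\<close>
      define K where "K j = closure {x. \<psi> j n x \<noteq> 0}" for j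
      have K: "compact (K j)" "K j \<subseteq> D j" "\<And>x. x \<notin> K j \<Longrightarrow> \<psi> j n x = 0" for j
        using \<psi>(1)[of j n] closure_subset[of "{x. \<psi> j n x \<noteq> 0}"]
        unfolding K_def test_fun_def by auto
      have "Ck k (\<psi> j n)" for j k
        using \<psi>(1)[of j n] by (simp add: test_fun_def)
      moreover have "D j \<subseteq> U" for j
        using \<D>(2) D by blast
      ultimately show ?thesis
        unfolding \<eta>_def using K
        by (intro test_funI[of _ "\<Union>j<n. K j"] Ck_diff Ck_prod Ck_const)
          (auto intro!: prod.neutral, blast)
    qed
    show "(\<lambda>n. \<eta> n x) \<longlonglongrightarrow> 1" if x: "x \<in> U" for x
    proof -
      have "\<Union>(range D) = U"
        by (simp add: D \<D>(4))
      then obtain j where j: "x \<in> D j"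
        using x by blast
      have "\<eta> n x \<ge> \<psi> j n x" if "n > j" for n
      proof -
        \<comment> \<open>The remaining factors lie in [0, 1], so \<eta> n x is squeezed between
          \<psi> j n x and 1.\<close>
        have "(\<Prod>j<n. 1 - \<psi> j n x) = (1 - \<psi> j n x) * (\<Prod>j\<in>{..<n} - {j}. 1 - \<psi> j n x)"
          using that by (subst prod.remove[of _ j]) auto
        also have "\<dots> \<le> (1 - \<psi> j n x) * 1"
          by (intro mult_left_mono prod_le_1) (auto simp: \<psi>)
        finally show ?thesis by (simp add: \<eta>_def)
      qed
      then have "\<forall>\<^sub>F n in sequentially. \<psi> j n x \<le> \<eta> n x"
        using eventually_gt_at_top[of j] by (rule eventually_mono[rotated])
      moreover have "\<forall>\<^sub>F n in sequentially. \<eta> n x \<le> 1"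
        unfolding \<eta>_def by (auto intro!: prod_nonneg always_eventually simp: \<psi>)
      ultimately show ?thesis
        using \<psi>(4)[OF j] by (rule tendsto_sandwich) auto
    qed
  qed
qed

text \<open>
  The integral of \<open>h\<close> vanishes over open sets, hence over measurable sets, since these are countable
  intersections of open sets up to null sets.
\<close>

lemma fundamental_lemma_variations:
  fixes \<Omega> :: "(real^'n) set"
  assumes "open \<Omega>" "\<Omega> \<in> lmeasurable" and int: "integrable (lebesgue_on \<Omega>) h"
    and zero: "\<And>\<phi>. \<phi> \<in> test_fun \<Omega> \<Longrightarrow> (LINT x|lebesgue_on \<Omega>. h x * \<phi> x) = 0"
  shows "AE x in lebesgue_on \<Omega>. h x = (0::real)"
proof (rule sigma_finite_measure.density_zero[OF _ int])
  show "sigma_finite_measure (lebesgue_on \<Omega>)"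
    using finite_measure_lebesgue_on[OF assms(2)] by (simp add: finite_measure_def)
  have [measurable]: "h \<in> borel_measurable (lebesgue_on \<Omega>)"
    using int by auto
  have \<Omega>: "\<Omega> \<in> sets lebesgue"
    using assms(1) by auto
  have open_ind: "indicator U \<in> borel_measurable (lebesgue_on \<Omega>)" if "open U" 
    for U :: "(real^'n) set"
    using that by (intro measurable_restrict_space1 measurable_completion) (auto intro: borel_measurable_indicator)
  have open_zero: "(LINT x|lebesgue_on \<Omega>. h x * indicator U x) = 0" if "open U" "U \<subseteq> \<Omega>" for U
  proof -
    obtain \<psi> where \<psi>: "\<And>n. \<psi> n \<in> test_fun U" "\<And>n x. 0 \<le> \<psi> n x" "\<And>n x. \<psi> n x \<le> (1::real)"
      "\<And>x. x \<in> U \<Longrightarrow> (\<lambda>n. \<psi> n x) \<longlonglongrightarrow> 1"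
      using test_fun_open[OF \<open>open U\<close>] by metis
    have in_\<Omega>: "\<psi> n \<in> test_fun \<Omega>" for n
      using \<psi>(1)[of n] that(2) by (auto simp: test_fun_def)
    have out: "\<psi> n x = 0" if "x \<notin> U" for n x
      using \<psi>(1)[of n] that by (auto elim!: test_funE)
    have [measurable]: "\<psi> n \<in> borel_measurable (lebesgue_on \<Omega>)" for n
      using \<psi>(1)[of n] \<Omega>
      by (intro continuous_imp_measurable_on_sets_lebesgue continuous_on_subset[OF Ck_imp_continuous])
        (auto simp: test_fun_def)
    note open_ind[OF \<open>open U\<close>, measurable]
    \<comment> \<open>The bumps converge pointwise to the indicator of U, and since they lie in
      [0, 1] the absolute value of h is a majorant.\<close>
    have "(\<lambda>n. LINT x|lebesgue_on \<Omega>. h x * \<psi> n x) \<longlonglongrightarrow>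
        (LINT x|lebesgue_on \<Omega>. h x * indicator U x)"
    proof (rule integral_dominated_convergence[where w = "\<lambda>x. \<bar>h x\<bar>"])
      show "AE x in lebesgue_on \<Omega>. (\<lambda>n. h x * \<psi> n x) \<longlonglongrightarrow> h x * indicator U x"
      proof (intro always_eventually allI tendsto_mult tendsto_const)
        show "(\<lambda>n. \<psi> n x) \<longlonglongrightarrow> indicator U x" for x
          by (cases "x \<in> U") (auto simp: \<psi>(4) out)
      qed
      show "AE x in lebesgue_on \<Omega>. norm (h x * \<psi> n x) \<le> \<bar>h x\<bar>" for n
        using \<psi>(2,3) by (auto simp: abs_mult intro!: always_eventually mult_left_le)
    qed (use int in auto)
    then show ?thesis
      using zero[OF in_\<Omega>] by (simp add: LIMSEQ_const_iff)
  qed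
  \<comment> \<open>By \<open>density_zero\<close> it remains to show that the integral of h over
    each measurable A vanishes.\<close>
  fix A assume "A \<in> sets (lebesgue_on \<Omega>)"
  then have A: "A \<in> sets lebesgue" "A \<subseteq> \<Omega>" and [measurable]: "A \<in> sets (lebesgue_on \<Omega>)"
    using \<Omega> by (auto simp: sets_restrict_space_iff)
  obtain C T where CT: "gdelta C" "T \<in> null_sets lebesgue" "A \<union> T = C" "disjnt A T"
    using lebesgue_set_almost_gdelta[OF A(1)] .
  obtain F :: "nat \<Rightarrow> (real^'n) set" where F: "\<And>n. open (F n)" "C = (\<Inter>n. F n)"
    using CT(1) by (auto elim!: gdelta.cases)
  \<comment> \<open>Finite intersections give decreasing open sets whose intersection is \<Omega>
    \<inter> C, which differs from A by a subset of the null set T.\<close>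
  define V where "V n = \<Omega> \<inter> (\<Inter>i\<le>n. F i)" for n
  have V: "open (V n)" for n
    unfolding V_def using F(1) assms(1) by (intro open_Int open_INT) auto
  note open_ind[OF V, measurable]
  have "(\<lambda>n. LINT x|lebesgue_on \<Omega>. h x * indicator (V n) x) \<longlonglongrightarrow>
      (LINT x|lebesgue_on \<Omega>. h x * indicator A x)"
  proof (rule integral_dominated_convergence[where w = "\<lambda>x. \<bar>h x\<bar>"])
    have "AE x in lebesgue_on \<Omega>. x \<notin> T"
      using AE_not_in[OF CT(2)] \<Omega> by (auto simp: AE_restrict_space_iff elim: eventually_mono)
    then show "AE x in lebesgue_on \<Omega>. (\<lambda>n. h x * indicator (V n) x) \<longlonglongrightarrow> h x * indicator A x"
    proof (eventually_elim, intro tendsto_mult tendsto_const)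
      fix x assume "x \<notin> T"
      show "(\<lambda>n. indicator (V n) x) \<longlonglongrightarrow> (indicator A x :: real)"
      proof (cases "x \<in> A")
        case True
        then have "x \<in> V n" for n
          using A(2) CT(3) F(2) by (auto simp: V_def)
        with True show ?thesis by simp
      next
        case False
        then obtain i where "x \<notin> F i"
          using \<open>x \<notin> T\<close> CT(3) F(2) by blast
        then have "\<forall>\<^sub>F n in sequentially. indicator A x = (indicator (V n) x :: real)"
          using False
          by (intro eventually_mono[OF eventually_ge_at_top[of i]]) (auto simp: V_def indicator_def)
        then show ?thesis by (rule Lim_transform_eventually[OF tendsto_const])
      qed
    qed
    show "AE x in lebesgue_on \<Omega>. norm (h x * indicator (V n) x) \<le> \<bar>h x\<bar>" for n
      by (auto simp: indicator_def)
  qed (use int in auto)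
  then show "set_lebesgue_integral (lebesgue_on \<Omega>) A h = 0"
    using open_zero[OF V]
    by (simp add: V_def LIMSEQ_const_iff set_lebesgue_integral_def mult.commute)
qed

section \<open>Integrals of derivatives of compactly supported functions\<close>

lemma bounded_range_compact_support:
  fixes f :: "'a::topological_space \<Rightarrow> 'b::real_normed_vector"
  assumes "continuous_on UNIV f" "compact K" "\<And>x. x \<notin> K \<Longrightarrow> f x = 0"
  shows "bounded (range f)"
proof -
  have "compact (f ` K)"
    using assms(1,2) continuous_on_subset by (intro compact_continuous_image) auto
  then have "bounded (insert 0 (f ` K))"
    by (simp add: compact_imp_bounded)
  then show ?thesis
    by (rule bounded_subset) (use assms(3) in auto)
qed

text \<open>The complement of K is open, so f agrees with the zero function near x.\<close>

lemma frechet_derivative_eq_0_outside: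
  assumes "closed K" "\<And>x. x \<notin> K \<Longrightarrow> f x = 0" "x \<notin> K"
  shows "frechet_derivative f (at x) = (\<lambda>_. 0)"
proof -
  have "(f has_derivative (\<lambda>_. 0)) (at x)"
    by (rule has_derivative_transform_within_open[of "\<lambda>_. 0" _ _ _ "- K"])
      (use assms in auto)
  then show ?thesis
    by (rule frechet_derivative_at[symmetric])
qed

lemma integrable_compact_support:
  fixes f :: "'a::euclidean_space \<Rightarrow> real"
  assumes "continuous_on UNIV f" "compact K" "\<And>x. x \<notin> K \<Longrightarrow> f x = 0"
  shows "integrable lborel f"
proof -
  have "integrable lborel (\<lambda>x. indicator K x *\<^sub>R f x)"
    using assms(1,2) continuous_on_subset by (intro borel_integrable_compact) auto
  moreover have "(\<lambda>x. indicator K x *\<^sub>R f x) = f"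
    using assms(3) by (auto simp: indicator_def fun_eq_iff)
  ultimately show ?thesis by simp
qed

lemma integral_shift:
  fixes f :: "'a::euclidean_space \<Rightarrow> real"
  assumes "integrable lborel f"
  shows "integrable lborel (\<lambda>x. f (c + x))" "(LINT x|lborel. f (c + x)) = (LINT x|lborel. f x)"
proof -
  have [measurable]: "f \<in> borel_measurable borel"
    using assms by auto
  show "integrable lborel (\<lambda>x. f (c + x))"
    using assms integrable_distr_eq[of "(+) c" lborel borel f]
    by (simp add: lborel_distr_plus)
  show "(LINT x|lborel. f (c + x)) = (LINT x|lborel. f x)"
    using integral_distr[of "(+) c" lborel borel f] by (simp add: lborel_distr_plus)
qed

text \<open>
  The integrals of the difference quotients vanish by translation invariance, and they converge
  dominatedly to the directional derivative.
\<close>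

lemma integral_frechet_derivative_eq_0:
  fixes f :: "'a::euclidean_space \<Rightarrow> real"
  assumes f: "Ck 1 f" and K: "compact K" "\<And>x. x \<notin> K \<Longrightarrow> f x = 0" and e: "e \<in> Basis"
  shows "(LINT x|lborel. frechet_derivative f (at x) e) = 0"
proof -
  let ?d = "\<lambda>x. frechet_derivative f (at x) e"
  \<comment> \<open>This is the difference quotient in direction e with step 1 / Suc n.\<close>
  define s where "s n x = real (Suc n) * (f (inverse (real (Suc n)) *\<^sub>R e + x) - f x)" for n x
  have cont: "continuous_on UNIV f" "continuous_on UNIV ?d"
    using f e Ck_imp_continuous[OF f] by auto
  have [measurable]: "f \<in> borel_measurable borel" "?d \<in> borel_measurable borel"
    using cont by (auto intro: borel_measurable_continuous_onI)
  have int: "integrable lborel f"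
    by (rule integrable_compact_support[OF cont(1) K])
  have s0: "(LINT x|lborel. s n x) = 0" for n
    unfolding s_def using int integral_shift[OF int, of "inverse (real (Suc n)) *\<^sub>R e"] by simp
  have D: "((\<lambda>t. f (t *\<^sub>R e + x)) has_real_derivative ?d (t *\<^sub>R e + x)) (at t)" for x t
  proof -
    have f': "(f has_derivative frechet_derivative f (at (t *\<^sub>R e + x))) (at (t *\<^sub>R e + x))"
      using f by (simp add: frechet_derivative_works)
    have "((\<lambda>t. f (t *\<^sub>R e + x)) has_derivative
        (\<lambda>h. frechet_derivative f (at (t *\<^sub>R e + x)) (h *\<^sub>R e))) (at t)"
      by (rule has_derivative_compose[of "\<lambda>t. t *\<^sub>R e + x" "\<lambda>h. h *\<^sub>R e" t UNIV f, OF _ f'])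
        (auto intro!: derivative_eq_intros)
    then show ?thesis
      using linear_scale[OF has_derivative_linear[OF f']]
      by (simp add: has_field_derivative_def mult.commute[of _ "?d _"])
  qed
  have lim: "(\<lambda>n. s n x) \<longlonglongrightarrow> ?d x" for x
  proof -
    have "((\<lambda>h. (f (h *\<^sub>R e + x) - f x) / h) \<longlongrightarrow> ?d x) (at 0)"
      using D[of x 0] by (simp add: DERIV_def)
    moreover have "filterlim (\<lambda>n. inverse (real (Suc n))) (at 0) sequentially"
      using LIMSEQ_inverse_real_of_nat by (auto simp: filterlim_at)
    ultimately have "(\<lambda>n. (f (inverse (real (Suc n)) *\<^sub>R e + x) - f x) / inverse (real (Suc n))) \<longlonglongrightarrow> ?d x"
      by (rule filterlim_compose)
    then show ?thesis
      by (simp add: s_def divide_inverse mult.commute del: of_nat_Suc)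
  qed
  have d0: "?d x = 0" if "x \<notin> K" for x
    using frechet_derivative_eq_0_outside[OF compact_imp_closed[OF K(1)] K(2) that] by simp
  obtain B where B: "\<And>x. \<bar>?d x\<bar> \<le> B"
    using bounded_range_compact_support[OF cont(2) K(1) d0] by (auto simp: bounded_iff)
  obtain R where R: "\<And>x. x \<in> K \<Longrightarrow> norm x \<le> R"
    using compact_imp_bounded[OF K(1)] by (auto simp: bounded_iff)
  \<comment> \<open>On the ball, the mean value theorem turns the quotient into a value of the
    derivative, bounded by B. Off the ball, a step of length at most 1 cannot reach K, so both
    values of f vanish.\<close>
  have s_bound: "\<bar>s n x\<bar> \<le> B * indicator (cball 0 (R + 1)) x" for n x
  proof (cases "x \<in> cball 0 (R + 1)")
    case True
    obtain z where "f (inverse (real (Suc n)) *\<^sub>R e + x) - f (0 *\<^sub>R e + x)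
        = (inverse (real (Suc n)) - 0) * ?d (z *\<^sub>R e + x)"
      using MVT2[of 0 "inverse (real (Suc n))", OF _ D] by (metis inverse_positive_iff_positive of_nat_0_less_iff zero_less_Suc)
    then have "s n x = ?d (z *\<^sub>R e + x)"
      by (simp add: s_def del: of_nat_Suc)
    with True B show ?thesis by simp
  next
    case False
    then have "norm x > R + 1" by simp
    moreover have "norm (inverse (real (Suc n)) *\<^sub>R e) \<le> 1"
      using e by (simp add: inverse_le_1_iff del: of_nat_Suc)
    ultimately have "norm (inverse (real (Suc n)) *\<^sub>R e + x) > R" "norm x > R"
      using norm_triangle_ineq2[of x "- (inverse (real (Suc n)) *\<^sub>R e)"]
      by (auto simp: add.commute)
    then have "f (inverse (real (Suc n)) *\<^sub>R e + x) = 0" "f x = 0"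
      using R K(2) by (meson not_le)+
    with False show ?thesis by (simp add: s_def)
  qed
  have "(\<lambda>n. LINT x|lborel. s n x) \<longlonglongrightarrow> (LINT x|lborel. ?d x)"
  proof (rule integral_dominated_convergence)
    show "integrable lborel (\<lambda>x. B * indicator (cball 0 (R + 1) :: 'a set) x)"
      using emeasure_bounded_finite[of "cball 0 (R + 1) :: 'a set"]
      by (intro integrable_mult_right integrable_real_indicator) auto
    show "AE x in lborel. norm (s n x) \<le> B * indicator (cball 0 (R + 1)) x" for n
      using s_bound by simp
  qed (use lim in \<open>auto simp: s_def[abs_def]\<close>)
  then show ?thesis
    by (simp add: s0 LIMSEQ_const_iff)
qed

section \<open>Square integrable functions\<close>

lemma L2_measurable: "f \<in> L2 \<Omega> \<Longrightarrow> f \<in> borel_measurable (lebesgue_on \<Omega>)"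
  by (simp add: L2_def)

lemma L2_integrable_norm2: "f \<in> L2 \<Omega> \<Longrightarrow> integrable (lebesgue_on \<Omega>) (\<lambda>x. (norm (f x))\<^sup>2)"
  by (simp add: L2_def)

text \<open>The pointwise Cauchy-Schwarz inequality and 2 s t \<le> s^2 + t^2 give an integrable
  majorant.\<close>

lemma integrable_inner_L2:
  assumes "f \<in> L2 \<Omega>" "g \<in> L2 \<Omega>"
  shows "integrable (lebesgue_on \<Omega>) (\<lambda>x. f x \<bullet> g x)"
proof (rule Bochner_Integration.integrable_bound)
  show "integrable (lebesgue_on \<Omega>) (\<lambda>x. (norm (f x))\<^sup>2 + (norm (g x))\<^sup>2)"
    using assms by (auto simp: L2_def)
  have "\<bar>f x \<bullet> g x\<bar> \<le> (norm (f x))\<^sup>2 + (norm (g x))\<^sup>2" for x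
    using Cauchy_Schwarz_ineq2[of "f x" "g x"] sum_squares_bound[of "norm (f x)" "norm (g x)"]
      mult_nonneg_nonneg[OF norm_ge_zero norm_ge_zero, of "f x" "g x"] by linarith
  then show "AE x in lebesgue_on \<Omega>. norm (f x \<bullet> g x) \<le> norm ((norm (f x))\<^sup>2 + (norm (g x))\<^sup>2)"
    by simp
qed (intro borel_measurable_inner assms[THEN L2_measurable])

lemma L2_add:
  assumes "f \<in> L2 \<Omega>" "g \<in> L2 \<Omega>"
  shows "(\<lambda>x. f x + g x) \<in> L2 \<Omega>"
proof -
  have "(\<lambda>x. (norm (f x + g x))\<^sup>2) = (\<lambda>x. (norm (f x))\<^sup>2 + (norm (g x))\<^sup>2 + 2 * (f x \<bullet> g x))"
    by (simp add: power2_norm_eq_inner inner_simps inner_commute fun_eq_iff)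
  then show ?thesis
    using assms integrable_inner_L2[OF assms] by (auto simp: L2_def)
qed

lemma L2_scaleR: "f \<in> L2 \<Omega> \<Longrightarrow> (\<lambda>x. c *\<^sub>R f x) \<in> L2 \<Omega>"
  by (auto simp: L2_def power_mult_distrib)

lemma L2_diff: "f \<in> L2 \<Omega> \<Longrightarrow> g \<in> L2 \<Omega> \<Longrightarrow> (\<lambda>x. f x - g x) \<in> L2 \<Omega>"
  using L2_add[OF _ L2_scaleR[of g \<Omega> "-1"], of f] by simp

lemma L2_nth:
  fixes f :: "real^'n \<Rightarrow> real^'m"
  assumes "f \<in> L2 \<Omega>"
  shows "(\<lambda>x. f x $ i) \<in> L2 \<Omega>"
proof -
  have [measurable]: "(\<lambda>x. f x $ i) \<in> borel_measurable (lebesgue_on \<Omega>)"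
    using borel_measurable_inner[OF L2_measurable[OF assms] borel_measurable_const, of "axis i 1"]
    by (simp add: inner_axis)
  have "(norm (f x $ i))\<^sup>2 \<le> (norm (f x))\<^sup>2" for x
    using component_le_norm_cart[of "f x" i] by (intro power_mono) auto
  then have "integrable (lebesgue_on \<Omega>) (\<lambda>x. (norm (f x $ i))\<^sup>2)"
    by (intro Bochner_Integration.integrable_bound[OF L2_integrable_norm2[OF assms]]) auto
  then show ?thesis by (simp add: L2_def)
qed

lemma L2_vecI:
  fixes f :: "real^'n \<Rightarrow> real^'m"
  assumes "\<And>i. (\<lambda>x. f x $ i) \<in> L2 \<Omega>"
  shows "f \<in> L2 \<Omega>"
proof -
  have "f \<in> borel_measurable (lebesgue_on \<Omega>)"
    using assms[THEN L2_measurable]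
    by (subst borel_measurable_euclidean_space) (auto simp: Basis_vec_def inner_axis)
  moreover have "(\<lambda>x. (norm (f x))\<^sup>2) = (\<lambda>x. \<Sum>i\<in>UNIV. (norm (f x $ i))\<^sup>2)"
    by (simp add: norm_vec_def L2_set_def sum_nonneg)
  ultimately show ?thesis
    using assms by (auto simp: L2_def)
qed

lemma zero_in_L2: "(\<lambda>x. 0) \<in> L2 \<Omega>"
  by (simp add: L2_def)

lemma L2_sum: "finite I \<Longrightarrow> (\<And>i. i \<in> I \<Longrightarrow> f i \<in> L2 \<Omega>) \<Longrightarrow> (\<lambda>x. \<Sum>i\<in>I. f i x) \<in> L2 \<Omega>"
  by (induction I rule: finite_induct) (auto intro: L2_add simp: zero_in_L2)

lemma L2_Linf_mult:
  assumes "c \<in> Linf \<Omega>" "f \<in> L2 \<Omega>"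
  shows "(\<lambda>x. c x * f x) \<in> L2 \<Omega>"
proof -
  obtain C where C: "AE x in lebesgue_on \<Omega>. \<bar>c x\<bar> \<le> C"
    and [measurable]: "c \<in> borel_measurable (lebesgue_on \<Omega>)"
    using assms(1) by (auto simp: Linf_def)
  note [measurable] = L2_measurable[OF assms(2)]
  have "integrable (lebesgue_on \<Omega>) (\<lambda>x. (norm (c x * f x))\<^sup>2)"
  proof (rule Bochner_Integration.integrable_bound)
    show "integrable (lebesgue_on \<Omega>) (\<lambda>x. C\<^sup>2 * (norm (f x))\<^sup>2)"
      using L2_integrable_norm2[OF assms(2)] by simp
    show "AE x in lebesgue_on \<Omega>. norm ((norm (c x * f x))\<^sup>2) \<le> norm (C\<^sup>2 * (norm (f x))\<^sup>2)"
      using C by eventually_elim (auto simp: power_mult_distrib intro!: mult_right_mono abs_le_square_iff[THEN iffD1])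
  qed measurable
  then show ?thesis by (simp add: L2_def)
qed

text \<open>Each component is a finite sum of products of a bounded entry of \<open>a\<close> with a
  square integrable component of \<zeta>.\<close>

lemma L2_conductivity_mult:
  fixes a :: "real^'n \<Rightarrow> real^'n^'n"
  assumes "conductivity \<Omega> a" "\<zeta> \<in> L2 \<Omega>"
  shows "(\<lambda>x. a x *v \<zeta> x) \<in> L2 \<Omega>"
  using assms
  by (intro L2_vecI) (auto simp: matrix_vector_mult_def conductivity_def intro!: L2_sum L2_Linf_mult L2_nth)

lemma L2_continuous_compact_support:
  fixes f :: "real^'n \<Rightarrow> 'b::euclidean_space"
  assumes "\<Omega> \<in> lmeasurable" "continuous_on UNIV f" "compact K" "\<And>x. x \<notin> K \<Longrightarrow> f x = 0"
  shows "f \<in> L2 \<Omega>"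
proof -
  interpret finite_measure "lebesgue_on \<Omega>"
    by (rule finite_measure_lebesgue_on[OF assms(1)])
  have [measurable]: "f \<in> borel_measurable (lebesgue_on \<Omega>)"
    using assms(1,2) continuous_on_subset
    by (intro continuous_imp_measurable_on_sets_lebesgue) auto
  obtain B where "\<And>x. norm (f x) \<le> B"
    using bounded_range_compact_support[OF assms(2-4)] by (auto simp: bounded_iff)
  then have "integrable (lebesgue_on \<Omega>) (\<lambda>x. (norm (f x))\<^sup>2)"
    by (intro integrable_const_bound[of _ "B\<^sup>2"]) (auto intro!: power_mono)
  then show ?thesis by (simp add: L2_def)
qed

section \<open>Weak gradients and potential parts\<close>

lemma grad_nth: "grad f x $ i = frechet_derivative f (at x) (axis i 1)"
  by (simp add: grad_def)

lemma continuous_on_grad: "Ck 1 f \<Longrightarrow> continuous_on UNIV (grad f)"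
  unfolding grad_def[abs_def] by (intro continuous_on_vec_lambda) simp

lemma test_fun_in_L2:
  assumes "\<Omega> \<in> lmeasurable" "\<phi> \<in> test_fun U"
  shows "\<phi> \<in> L2 \<Omega>" "grad \<phi> \<in> L2 \<Omega>"
proof -
  obtain K where K: "\<And>k. Ck k \<phi>" "compact K" "\<And>x. x \<notin> K \<Longrightarrow> \<phi> x = 0" "K \<subseteq> U"
    using assms(2) by (metis test_funE)
  show "\<phi> \<in> L2 \<Omega>"
    by (rule L2_continuous_compact_support[OF assms(1) Ck_imp_continuous[OF K(1)[of 0]] K(2,3)])
  have "grad \<phi> x = 0" if "x \<notin> K" for x
    using frechet_derivative_eq_0_outside[OF compact_imp_closed[OF K(2)] K(3) that]
    by (simp add: grad_def vec_eq_iff)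
  then show "grad \<phi> \<in> L2 \<Omega>"
    by (rule L2_continuous_compact_support[OF assms(1) continuous_on_grad[OF K(1)] K(2)])
qed

text \<open>The gradient vanishes off \<Omega>, so the integral may be taken over the whole space
  and no boundary term arises.\<close>

lemma integral_grad_test_fun:
  assumes "\<Omega> \<in> sets lebesgue" "\<phi> \<in> test_fun \<Omega>"
  shows "(LINT x|lebesgue_on \<Omega>. grad \<phi> x $ i) = 0"
proof -
  obtain K where K: "\<And>k. Ck k \<phi>" "compact K" "\<And>x. x \<notin> K \<Longrightarrow> \<phi> x = 0" "K \<subseteq> \<Omega>"
    using assms(2) by (metis test_funE)
  have [measurable]: "(\<lambda>x. grad \<phi> x $ i) \<in> borel_measurable borel"
    using continuous_on_grad[OF K(1)] by (intro borel_measurable_continuous_onI continuous_intros)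
  have "grad \<phi> x $ i = 0" if "x \<notin> \<Omega>" for x
    using frechet_derivative_eq_0_outside[OF compact_imp_closed[OF K(2)] K(3)] that K(4)
    by (subst grad_nth) fastforce
  then have "(\<lambda>x. indicator \<Omega> x *\<^sub>R grad \<phi> x $ i) = (\<lambda>x. grad \<phi> x $ i)"
    by (auto simp: indicator_def fun_eq_iff)
  then have "(LINT x|lebesgue_on \<Omega>. grad \<phi> x $ i) = (LINT x|lborel. grad \<phi> x $ i)"
    using assms(1) by (simp add: integral_restrict_space integral_completion)
  also have "\<dots> = 0"
    unfolding grad_nth
    by (rule integral_frechet_derivative_eq_0[OF K(1-3)]) (auto simp: Basis_vec_def)
  finally show ?thesis .
qed

text \<open>Integration by parts: the product \<phi> \<psi> is again a test function, so the
  integral of its gradient vanishes, and the product rule splits it.\<close>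

lemma has_weak_grad_test_fun:
  assumes "\<Omega> \<in> lmeasurable" "\<phi> \<in> test_fun \<Omega>"
  shows "has_weak_grad \<Omega> \<phi> (grad \<phi>)"
  unfolding has_weak_grad_def
proof (intro ballI allI)
  fix \<psi> :: "real^'a \<Rightarrow> real" and i assume \<psi>: "\<psi> \<in> test_fun \<Omega>"
  have "\<phi> differentiable (at x)" "\<psi> differentiable (at x)" for x
    using assms(2) \<psi> by (auto simp: test_fun_def dest: spec[of _ 1])
  then have "grad (\<lambda>x. \<phi> x * \<psi> x) x $ i = \<phi> x * grad \<psi> x $ i + grad \<phi> x $ i * \<psi> x" for x
    by (simp add: grad_nth frechet_derivative_mult_real)
  moreover have "integrable (lebesgue_on \<Omega>) (\<lambda>x. \<phi> x * grad \<psi> x $ i)"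
    "integrable (lebesgue_on \<Omega>) (\<lambda>x. grad \<phi> x $ i * \<psi> x)"
    using integrable_inner_L2[OF test_fun_in_L2(1)[OF assms] L2_nth[OF test_fun_in_L2(2)[OF assms(1) \<psi>]]]
      integrable_inner_L2[OF L2_nth[OF test_fun_in_L2(2)[OF assms]] test_fun_in_L2(1)[OF assms(1) \<psi>]]
    by simp_all
  ultimately show "(LINT x|lebesgue_on \<Omega>. \<phi> x * grad \<psi> x $ i)
      = - (LINT x|lebesgue_on \<Omega>. grad \<phi> x $ i * \<psi> x)"
    using integral_grad_test_fun[OF _ test_fun_mult[OF assms(2) \<psi>], of i] assms(1)
    by (simp add: fmeasurableD)
qed

text \<open>On a set of finite measure the constant 1 is square integrable and can be paired with
  f.\<close>

lemma integrable_L2: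
  fixes f :: "real^'n \<Rightarrow> real"
  assumes "\<Omega> \<in> lmeasurable" "f \<in> L2 \<Omega>"
  shows "integrable (lebesgue_on \<Omega>) f"
proof -
  interpret finite_measure "lebesgue_on \<Omega>"
    by (rule finite_measure_lebesgue_on[OF assms(1)])
  have "(\<lambda>x. 1 :: real) \<in> L2 \<Omega>"
    by (simp add: L2_def)
  from integrable_inner_L2[OF assms(2) this] show ?thesis
    by simp
qed

text \<open>Each component of the difference integrates to 0 against every test function. This pins
  down the arbitrary choice in \<open>weak_grad\<close> almost everywhere.\<close>

lemma has_weak_grad_unique:
  assumes \<Omega>: "open \<Omega>" "\<Omega> \<in> lmeasurable" and "g \<in> L2 \<Omega>" "h \<in> L2 \<Omega>"
    and "has_weak_grad \<Omega> u g" "has_weak_grad \<Omega> u h"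
  shows "AE x in lebesgue_on \<Omega>. g x = h x"
proof -
  have "AE x in lebesgue_on \<Omega>. g x $ i - h x $ i = 0" for i
  proof (rule fundamental_lemma_variations[OF \<Omega>])
    have gi: "(\<lambda>x. g x $ i) \<in> L2 \<Omega>" and hi: "(\<lambda>x. h x $ i) \<in> L2 \<Omega>"
      using assms(3,4) by (auto intro: L2_nth)
    show "integrable (lebesgue_on \<Omega>) (\<lambda>x. g x $ i - h x $ i)"
      by (rule integrable_L2[OF \<Omega>(2) L2_diff[OF gi hi]])
    fix \<phi> assume \<phi>: "\<phi> \<in> test_fun \<Omega>"
    have "integrable (lebesgue_on \<Omega>) (\<lambda>x. g x $ i * \<phi> x)" "integrable (lebesgue_on \<Omega>) (\<lambda>x. h x $ i * \<phi> x)"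
      using integrable_inner_L2[OF gi test_fun_in_L2(1)[OF \<Omega>(2) \<phi>]]
        integrable_inner_L2[OF hi test_fun_in_L2(1)[OF \<Omega>(2) \<phi>]] by simp_all
    moreover have "(LINT x|lebesgue_on \<Omega>. g x $ i * \<phi> x) = (LINT x|lebesgue_on \<Omega>. h x $ i * \<phi> x)"
      using assms(5,6)[unfolded has_weak_grad_def, rule_format, OF \<phi>, of i] by simp
    ultimately show "(LINT x|lebesgue_on \<Omega>. (g x $ i - h x $ i) * \<phi> x) = 0"
      by (simp add: left_diff_distrib)
  qed
  then have "AE x in lebesgue_on \<Omega>. \<forall>i. g x $ i - h x $ i = 0"
    by (simp add: AE_all_countable)
  then show ?thesis
    by eventually_elim (simp add: vec_eq_iff)
qed

lemma weak_grad:
  assumes "u \<in> H1 \<Omega>"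
  shows "weak_grad \<Omega> u \<in> L2 \<Omega>" "has_weak_grad \<Omega> u (weak_grad \<Omega> u)"
proof -
  have "\<exists>g. g \<in> L2 \<Omega> \<and> has_weak_grad \<Omega> u g"
    using assms by (auto simp: H1_def)
  from someI_ex[OF this] show "weak_grad \<Omega> u \<in> L2 \<Omega>" "has_weak_grad \<Omega> u (weak_grad \<Omega> u)"
    by (simp_all add: weak_grad_def)
qed

lemma test_fun_in_H1: "\<Omega> \<in> lmeasurable \<Longrightarrow> \<phi> \<in> test_fun \<Omega> \<Longrightarrow> \<phi> \<in> H1 \<Omega>"
  using test_fun_in_L2[of \<Omega> \<phi> \<Omega>] has_weak_grad_test_fun[of \<Omega> \<phi>] unfolding H1_def by blast

lemma weak_grad_test_fun:
  assumes "open \<Omega>" "\<Omega> \<in> lmeasurable" "\<phi> \<in> test_fun \<Omega>"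
  shows "AE x in lebesgue_on \<Omega>. weak_grad \<Omega> \<phi> x = grad \<phi> x"
  by (rule has_weak_grad_unique[OF assms(1,2) weak_grad(1) test_fun_in_L2(2)[OF assms(2,3)]
        weak_grad(2) has_weak_grad_test_fun[OF assms(2,3)]])
    (rule test_fun_in_H1[OF assms(2,3)])+

text \<open>A test function approximates itself. The error is the zero function, but its
  \<open>weak_grad\<close> is chosen by \<open>SOME\<close>, so uniqueness is what shows that its
  \<open>H1_norm\<close> is 0.\<close>

lemma test_fun_in_H10:
  assumes "open \<Omega>" "\<Omega> \<in> lmeasurable" "\<phi> \<in> test_fun \<Omega>"
  shows "\<phi> \<in> H10 \<Omega>"
proof -
  have "(\<lambda>x. 0) \<in> test_fun \<Omega>"
    by (rule test_funI[of _ "{}"]) (simp_all add: Ck_const)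
  then have "AE x in lebesgue_on \<Omega>. weak_grad \<Omega> (\<lambda>x. 0) x = grad (\<lambda>x. 0) x"
    by (rule weak_grad_test_fun[OF assms(1,2)])
  then have "AE x in lebesgue_on \<Omega>. (norm (weak_grad \<Omega> (\<lambda>x. 0) x))\<^sup>2 = 0"
    by eventually_elim (simp add: grad_def zero_vec_def[symmetric])
  then have "L2_norm \<Omega> (weak_grad \<Omega> (\<lambda>x. 0)) = 0"
    by (simp only: L2_norm_def integral_eq_zero_AE real_sqrt_zero)
  then have "H1_norm \<Omega> (\<lambda>x. \<phi> x - \<phi> x) = 0"
    by (simp add: H1_norm_def) (simp add: L2_norm_def)
  then show ?thesis
    using assms test_fun_in_H1 by (auto simp: H10_def intro!: bexI[of _ \<phi>])
qed

section \<open>Inner products and orthogonality to a closure\<close>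

lemma L2_inner_cong_AE:
  assumes "AE x in lebesgue_on \<Omega>. g x = h x" "f \<in> L2 \<Omega>" "g \<in> L2 \<Omega>" "h \<in> L2 \<Omega>"
  shows "L2_inner \<Omega> f g = L2_inner \<Omega> f h"
  unfolding L2_inner_def using assms(1)
  by (intro integral_cong_AE borel_measurable_inner L2_measurable assms) auto

lemma L2_inner_diff:
  assumes "f \<in> L2 \<Omega>" "g \<in> L2 \<Omega>" "h \<in> L2 \<Omega>"
  shows "L2_inner \<Omega> (\<lambda>x. f x - g x) h = L2_inner \<Omega> f h - L2_inner \<Omega> g h"
    "L2_inner \<Omega> h (\<lambda>x. f x - g x) = L2_inner \<Omega> h f - L2_inner \<Omega> h g"
  using integrable_inner_L2[OF assms(1,3)] integrable_inner_L2[OF assms(2,3)]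
    integrable_inner_L2[OF assms(3,1)] integrable_inner_L2[OF assms(3,2)]
  by (simp_all add: L2_inner_def inner_diff_left inner_diff_right)

text \<open>A weighted Young inequality does the work of Cauchy-Schwarz in \<open>L2\<close>; the
  weight t is later matched to the size of g.\<close>

lemma L2_inner_le:
  assumes "f \<in> L2 \<Omega>" "g \<in> L2 \<Omega>" and t: "t > 0"
  shows "\<bar>L2_inner \<Omega> f g\<bar> \<le> (L2_norm \<Omega> f)\<^sup>2 * t + (L2_norm \<Omega> g)\<^sup>2 / t"
proof -
  have "\<bar>f x \<bullet> g x\<bar> \<le> (norm (f x))\<^sup>2 * t + (norm (g x))\<^sup>2 / t" for x
  proof -
    \<comment> \<open>The weights are sqrt t on one factor and 1 / sqrt t on the other.\<close>
    have "2 * (norm (f x) * norm (g x)) \<le> (norm (f x))\<^sup>2 * t + (norm (g x))\<^sup>2 / t"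
      using sum_squares_bound[of "norm (f x) * sqrt t" "norm (g x) / sqrt t"] t
      by (simp add: power_mult_distrib power_divide)
    then show ?thesis
      using Cauchy_Schwarz_ineq2[of "f x" "g x"]
        mult_nonneg_nonneg[OF norm_ge_zero norm_ge_zero, of "f x" "g x"] by linarith
  qed
  then have "(LINT x|lebesgue_on \<Omega>. \<bar>f x \<bullet> g x\<bar>)
      \<le> (LINT x|lebesgue_on \<Omega>. (norm (f x))\<^sup>2 * t + (norm (g x))\<^sup>2 / t)"
    using assms
    by (intro integral_mono integrable_abs integrable_inner_L2) (auto simp: L2_def)
  also have "\<dots> = (L2_norm \<Omega> f)\<^sup>2 * t + (L2_norm \<Omega> g)\<^sup>2 / t"
    using assms by (simp add: L2_def L2_norm_def)
  finally show ?thesis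
    unfolding L2_inner_def
    using integral_abs_bound[of "lebesgue_on \<Omega>" "\<lambda>x. f x \<bullet> g x"] by linarith
qed

text \<open>Replace q by its distance to some g in S with error below t. With the same t as weight,
  \<open>L2_inner_le\<close> bounds the inner product by a fixed multiple of t, and t is
  arbitrary.\<close>

lemma L2_inner_closure_eq_0:
  assumes f: "f \<in> L2 \<Omega>" and S: "S \<subseteq> L2 \<Omega>" "\<And>g. g \<in> S \<Longrightarrow> L2_inner \<Omega> f g = 0"
    and q: "q \<in> L2_closure \<Omega> S"
  shows "L2_inner \<Omega> f q = 0"
proof -
  have q2: "q \<in> L2 \<Omega>"
    using q by (simp add: L2_closure_def)
  have "\<bar>L2_inner \<Omega> f q\<bar> \<le> ((L2_norm \<Omega> f)\<^sup>2 + 1) * t" if t: "t > 0" for t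
  proof -
    obtain g where g: "g \<in> S" "L2_norm \<Omega> (\<lambda>x. q x - g x) < t"
      using q t by (auto simp: L2_closure_def)
    have g2: "g \<in> L2 \<Omega>"
      using g(1) S(1) by auto
    have "0 \<le> L2_norm \<Omega> (\<lambda>x. q x - g x)"
      by (simp add: L2_norm_def)
    then have "(L2_norm \<Omega> (\<lambda>x. q x - g x))\<^sup>2 \<le> t\<^sup>2"
      using g(2) by (intro power_mono) auto
    then have "(L2_norm \<Omega> (\<lambda>x. q x - g x))\<^sup>2 / t \<le> t"
      using that by (simp add: field_simps power2_eq_square)
    moreover have "L2_inner \<Omega> f q = L2_inner \<Omega> f (\<lambda>x. q x - g x)"
      using L2_inner_diff(2)[OF q2 g2 f] S(2)[OF g(1)] by simp
    ultimately show ?thesis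
      using L2_inner_le[OF f L2_diff[OF q2 g2] that] by (simp add: algebra_simps)
  qed
  note bound = this
  have "(\<lambda>n. ((L2_norm \<Omega> f)\<^sup>2 + 1) * inverse (real (Suc n))) \<longlonglongrightarrow> 0"
    using tendsto_mult_right_zero[OF LIMSEQ_inverse_real_of_nat] .
  then have "\<bar>L2_inner \<Omega> f q\<bar> \<le> 0"
    by (rule LIMSEQ_le_const) (auto intro!: bound)
  then show ?thesis by simp
qed

text \<open>
  The defining property of the projection depends on the field only through its inner products
  with gradients of test functions. As \<open>pot\<close> selects by \<open>SOME\<close>, equal properties give equal
  values, and the existence of the projection is not needed.
\<close>

lemma pot_cong:
  assumes \<Omega>: "\<Omega> \<in> lmeasurable" and FG: "F \<in> L2 \<Omega>" "G \<in> L2 \<Omega>"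
    and eq: "\<And>\<phi>. \<phi> \<in> test_fun \<Omega> \<Longrightarrow> L2_inner \<Omega> F (grad \<phi>) = L2_inner \<Omega> G (grad \<phi>)"
  shows "pot \<Omega> F = pot \<Omega> G"
proof -
  let ?S = "L2_closure \<Omega> (grad ` test_fun \<Omega>)"
  have S2: "grad ` test_fun \<Omega> \<subseteq> L2 \<Omega>"
    using test_fun_in_L2(2)[OF \<Omega>] by auto
  \<comment> \<open>F - G is orthogonal to the gradients of test functions, hence to their
    closure.\<close>
  have "L2_inner \<Omega> (\<lambda>x. F x - G x) q = 0" if "q \<in> ?S" for q
  proof (rule L2_inner_closure_eq_0[OF L2_diff[OF FG] S2 _ that])
    show "L2_inner \<Omega> (\<lambda>x. F x - G x) g = 0" if "g \<in> grad ` test_fun \<Omega>" for g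
      using that eq L2_inner_diff(1)[OF FG test_fun_in_L2(2)[OF \<Omega>]] by auto
  qed
  then have "L2_inner \<Omega> (\<lambda>x. F x - p x) q = L2_inner \<Omega> (\<lambda>x. G x - p x) q" if "p \<in> ?S" "q \<in> ?S" for p q
    using that FG by (simp add: L2_inner_diff(1) L2_closure_def)
  \<comment> \<open>The two selecting predicates coincide as functions, so \<open>SOME\<close>
    returns the same field for both.\<close>
  then have "(\<lambda>p. p \<in> ?S \<and> (\<forall>q\<in>?S. L2_inner \<Omega> (\<lambda>x. F x - p x) q = 0))
      = (\<lambda>p. p \<in> ?S \<and> (\<forall>q\<in>?S. L2_inner \<Omega> (\<lambda>x. G x - p x) q = 0))"
    by (intro ext) auto
  then show ?thesis
    unfolding pot_def L2_proj_def by (rule arg_cong)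
qed

section \<open>Comparison of the two fluxes\<close>

lemma L2_inner_flux_diff:
  assumes a: "conductivity \<Omega> a" and u: "weak_solution \<Omega> a f u" and "\<zeta> \<in> L2 \<Omega>" "v \<in> H10 \<Omega>"
  shows "L2_inner \<Omega> (\<lambda>x. a x *v (weak_grad \<Omega> u x - \<zeta> x)) (weak_grad \<Omega> v)
      = L2_inner \<Omega> f v + div_Hm1 \<Omega> (\<lambda>x. a x *v \<zeta> x) v"
proof -
  have "u \<in> H1 \<Omega>" "v \<in> H1 \<Omega>"
    using u assms(4) by (auto simp: weak_solution_def H10_def)
  then have L2: "(\<lambda>x. a x *v weak_grad \<Omega> u x) \<in> L2 \<Omega>" "(\<lambda>x. a x *v \<zeta> x) \<in> L2 \<Omega>"
      "weak_grad \<Omega> v \<in> L2 \<Omega>"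
    using L2_conductivity_mult[OF a] weak_grad(1) assms(3) by auto
  \<comment> \<open>The weak equation tested with v yields the term in f; the minus sign inside
    \<open>div_Hm1\<close> turns the subtracted \<zeta> term into a sum.\<close>
  show ?thesis
    using L2_inner_diff(1)[OF L2] u assms(4)
    by (simp add: weak_solution_def div_Hm1_def matrix_vector_mult_diff_distrib)
qed

text \<open>By \<open>L2_inner_flux_diff\<close>, testing either flux difference with v in
  \<open>H10\<close> gives f paired with v plus a divergence, and the two divergences agree.\<close>

lemma pot_flux_diff_eq:
  fixes \<Omega> :: "(real^'n) set"
  assumes \<Omega>: "open \<Omega>" "\<Omega> \<in> lmeasurable"
    and a: "conductivity \<Omega> a" "conductivity \<Omega> a'"
    and u: "weak_solution \<Omega> a f u" "weak_solution \<Omega> a' f u'"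
    and \<zeta>: "\<zeta> \<in> L2 \<Omega>" "\<zeta>' \<in> L2 \<Omega>"
    and div: "div_Hm1 \<Omega> (\<lambda>x. a x *v \<zeta> x) = div_Hm1 \<Omega> (\<lambda>x. a' x *v \<zeta>' x)"
  shows "pot \<Omega> (\<lambda>x. a x *v (weak_grad \<Omega> u x - \<zeta> x))
    = pot \<Omega> (\<lambda>x. a' x *v (weak_grad \<Omega> u' x - \<zeta>' x))" (is "pot \<Omega> ?F = pot \<Omega> ?G")
proof (rule pot_cong[OF \<Omega>(2)])
  show F: "?F \<in> L2 \<Omega>" and G: "?G \<in> L2 \<Omega>"
    using u a \<zeta>
    by (auto intro!: L2_conductivity_mult L2_diff weak_grad simp: weak_solution_def H10_def)
  fix \<phi> assume \<phi>: "\<phi> \<in> test_fun \<Omega>"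
  note ae = weak_grad_test_fun[OF \<Omega> \<phi>] and L2 = weak_grad(1)[OF test_fun_in_H1[OF \<Omega>(2) \<phi>]]
    test_fun_in_L2(2)[OF \<Omega>(2) \<phi>]
  \<comment> \<open>Divergences act through \<open>weak_grad\<close>, whereas \<open>pot\<close> is
    built from \<open>grad\<close>; the two gradients of \<phi> agree almost everywhere, which
    transfers the equality.\<close>
  have "L2_inner \<Omega> ?F (weak_grad \<Omega> \<phi>) = L2_inner \<Omega> ?G (weak_grad \<Omega> \<phi>)"
    using L2_inner_flux_diff[OF a(1) u(1) \<zeta>(1) test_fun_in_H10[OF \<Omega> \<phi>]]
      L2_inner_flux_diff[OF a(2) u(2) \<zeta>(2) test_fun_in_H10[OF \<Omega> \<phi>]] div by simp
  then show "L2_inner \<Omega> ?F (grad \<phi>) = L2_inner \<Omega> ?G (grad \<phi>)"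
    using L2_inner_cong_AE[OF ae F L2] L2_inner_cong_AE[OF ae G L2] by simp
qed

theorem theorem2p2:
  fixes \<Omega> :: "(real^'n) set"
    and a a' :: "real^'n \<Rightarrow> real^'n^'n"
    and V V' :: "(real^'n \<Rightarrow> real^'n) set"
    and u u' :: "(real^'n \<Rightarrow> real) \<Rightarrow> real^'n \<Rightarrow> real"
  assumes "CARD('n) \<ge> 2"
    and "bounded_C2_domain \<Omega>"
    and "conductivity \<Omega> a"
    and "conductivity \<Omega> a'"
    and "finite_dim_L2_subspace \<Omega> V"
    and "finite_dim_L2_subspace \<Omega> V'"
    and "\<And>f. f \<in> L2 \<Omega> \<Longrightarrow> weak_solution \<Omega> a f (u f)"
    and "\<And>f. f \<in> L2 \<Omega> \<Longrightarrow> weak_solution \<Omega> a' f (u' f)"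
    and "{div_Hm1 \<Omega> (\<lambda>x. a x *v \<zeta> x) | \<zeta>. \<zeta> \<in> V} = {div_Hm1 \<Omega> (\<lambda>x. a' x *v \<zeta> x) | \<zeta>. \<zeta> \<in> V'}"
  shows "(SUP f\<in>{f \<in> L2 \<Omega>. L2_norm \<Omega> f \<noteq> 0}. INF \<zeta>\<in>V.
            ereal (L2_norm \<Omega> (pot \<Omega> (\<lambda>x. a x *v (weak_grad \<Omega> (u f) x - \<zeta> x))) / L2_norm \<Omega> f)) =
         (SUP f\<in>{f \<in> L2 \<Omega>. L2_norm \<Omega> f \<noteq> 0}. INF \<zeta>\<in>V'.
            ereal (L2_norm \<Omega> (pot \<Omega> (\<lambda>x. a' x *v (weak_grad \<Omega> (u' f) x - \<zeta> x))) / L2_norm \<Omega> f))"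
proof (rule SUP_cong[OF refl])
  fix f :: "real^'n \<Rightarrow> real" assume "f \<in> {f \<in> L2 \<Omega>. L2_norm \<Omega> f \<noteq> 0}"
  then have f: "f \<in> L2 \<Omega>" by simp
  have \<Omega>: "open \<Omega>" "\<Omega> \<in> lmeasurable"
    using assms(2) by (auto simp: bounded_C2_domain_def lmeasurable_open)
  have V: "\<zeta> \<in> L2 \<Omega>" if "\<zeta> \<in> V" for \<zeta>
    using assms(5) that by (auto simp: finite_dim_L2_subspace_def L2_subspace_def)
  have V': "\<zeta> \<in> L2 \<Omega>" if "\<zeta> \<in> V'" for \<zeta>
    using assms(6) that by (auto simp: finite_dim_L2_subspace_def L2_subspace_def)
  note pot_eq = pot_flux_diff_eq[OF \<Omega> assms(3,4) assms(7,8)[OF f] V V']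
  \<comment> \<open>Matching each field with one of equal divergence gives equality of whole sets of
    potential parts; no bijection between \<open>V\<close> and \<open>V'\<close> is
    involved.\<close>
  have "(\<lambda>\<zeta>. pot \<Omega> (\<lambda>x. a x *v (weak_grad \<Omega> (u f) x - \<zeta> x))) ` V
      = (\<lambda>\<zeta>. pot \<Omega> (\<lambda>x. a' x *v (weak_grad \<Omega> (u' f) x - \<zeta> x))) ` V'" (is "?p ` V = ?p' ` V'")
  proof (intro equalityI image_subsetI)
    fix \<zeta> assume \<zeta>: "\<zeta> \<in> V"
    then have "div_Hm1 \<Omega> (\<lambda>x. a x *v \<zeta> x) \<in> {div_Hm1 \<Omega> (\<lambda>x. a' x *v \<zeta> x) | \<zeta>. \<zeta> \<in> V'}"
      unfolding assms(9)[symmetric] by blast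
    then obtain \<zeta>' where "\<zeta>' \<in> V'"
      "div_Hm1 \<Omega> (\<lambda>x. a x *v \<zeta> x) = div_Hm1 \<Omega> (\<lambda>x. a' x *v \<zeta>' x)"
      by auto
    then show "?p \<zeta> \<in> ?p' ` V'"
      using pot_eq[OF \<zeta>] by blast
  next
    fix \<zeta>' assume \<zeta>': "\<zeta>' \<in> V'"
    then have "div_Hm1 \<Omega> (\<lambda>x. a' x *v \<zeta>' x) \<in> {div_Hm1 \<Omega> (\<lambda>x. a x *v \<zeta> x) | \<zeta>. \<zeta> \<in> V}"
      unfolding assms(9) by blast
    then obtain \<zeta> where \<zeta>: "\<zeta> \<in> V" and div:
      "div_Hm1 \<Omega> (\<lambda>x. a x *v \<zeta> x) = div_Hm1 \<Omega> (\<lambda>x. a' x *v \<zeta>' x)"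
      by auto
    show "?p' \<zeta>' \<in> ?p ` V"
      by (rule image_eqI[where x = \<zeta>]) (rule pot_eq[OF \<zeta> \<zeta>' div, symmetric], rule \<zeta>)
  qed
  \<comment> \<open>Each quotient depends on \<zeta> only through its potential part, so both infima
    are over the same set of numbers.\<close>
  then have "(\<lambda>p. ereal (L2_norm \<Omega> p / L2_norm \<Omega> f)) ` (?p ` V)
      = (\<lambda>p. ereal (L2_norm \<Omega> p / L2_norm \<Omega> f)) ` (?p' ` V')"
    by simp
  then show "(INF \<zeta>\<in>V. ereal (L2_norm \<Omega> (?p \<zeta>) / L2_norm \<Omega> f))
      = (INF \<zeta>\<in>V'. ereal (L2_norm \<Omega> (?p' \<zeta>) / L2_norm \<Omega> f))"
    unfolding image_image by (rule arg_cong)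
qed

end
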